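(* Let $P$ be a poset with $n$ elements and let $E$ be a chain congruence on $P$. Then $$K_{P,E}(\mathbf x)=\sum_{\alpha\vDash n}\frac{\Psi_\alpha(\mathbf x)}{z_\alpha}\sum_{f\in\mathcal O^*_\alpha(P,E)}\prod_{i=1}^{\ell(\alpha)}\bigl|[\min f^{-1}(i)]_E\bigr|.$$ In particular $K_{P,E}$ is $\Psi$-positive.
   Context: $K_{P,E}(\mathbf x)=\sum_f\prod_{x\in P}x_{f(x)}$ over all $f:P\to\mathbb Z_{>0}$ with $x<_Py\Rightarrow f(x)\le f(y)$ and $x\sim_Ey\Rightarrow f(x)=f(y)$. $E$ is a chain congruence on $P$ if every class $[x]_E$ is a chain and whenever $x<_Py$, $x\not\sim_Ey$, then $\max[x]_E<_P\min[y]_E$. For a composition $\alpha=(\alpha_1,\dots,\alpha_\ell)$ of $n$, $\mathcal O^*_\alpha(P)$ is the set of surjections $f:P\to[\ell]$ with $x\le_Py\Rightarrow f(x)\le f(y)$, $|f^{-1}(i)|=\alpha_i$, and each fiber $f^{-1}(i)$ having a unique minimal element $\min f^{-1}(i)$; $\mathcal O^*_\alpha(P,E)$ is the subset of those $f$ with $f(x)=f(y)$ whenever $x\sim_Ey$. $S_\alpha=\{\alpha_1,\dots,\alpha_1+\dots+\alpha_{\ell-1}\}$; blocks $B_i(\alpha)$ are the consecutive intervals of $[n]$ of sizes $\alpha_i$; $\alpha\le\beta$ iff $S_\beta\subseteq S_\alpha$. $M_\alpha=\sum_{i_1<\dots<i_\ell}x_{i_1}^{\alpha_1}\cdots x_{i_\ell}^{\alpha_\ell}$;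 $z_\alpha=\prod_i i^{m_i}m_i!$; $\pi(\gamma)=\prod_i(\gamma_1+\dots+\gamma_i)$; $\pi(\alpha,\beta)=\prod_{i}\pi(\alpha^{(i)})$ with $\alpha^{(i)}$ the parts of $\alpha$ whose blocks lie in $B_i(\beta)$; $\Psi_\alpha=z_\alpha\sum_{\beta\ge\alpha}\pi(\alpha,\beta)^{-1}M_\beta$. *)

theory Defs
  imports Complex_Main "HOL-Library.FuncSet"
begin

text \<open>Posets: a finite carrier P with a partial order R (library partial_order_on).
  Equivalences E on P: library equiv. Compositions are lists of positive naturals.
  Formal power series in x_1, x_2, ... are represented by their coefficient
  functions on monomials; a monomial x^m is an exponent vector m :: nat => nat
  with finite support and m 0 = 0 (variables are indexed by positive integers).\<close>

definition strict :: "('a \<times> 'a) set \<Rightarrow> 'a \<Rightarrow> 'a \<Rightarrow> bool" where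
  "strict R x y \<longleftrightarrow> (x, y) \<in> R \<and> x \<noteq> y"

definition cls_max :: "('a \<times> 'a) set \<Rightarrow> 'a set \<Rightarrow> 'a" where
  "cls_max R C = (THE z. z \<in> C \<and> (\<forall>w\<in>C. (w, z) \<in> R))"

definition cls_min :: "('a \<times> 'a) set \<Rightarrow> 'a set \<Rightarrow> 'a" where
  "cls_min R C = (THE z. z \<in> C \<and> (\<forall>w\<in>C. (z, w) \<in> R))"

definition is_chain_in :: "('a \<times> 'a) set \<Rightarrow> 'a set \<Rightarrow> bool" where
  "is_chain_in R C \<longleftrightarrow> (\<forall>a\<in>C. \<forall>b\<in>C. (a, b) \<in> R \<or> (b, a) \<in> R)"

definition chain_congruence :: "'a set \<Rightarrow> ('a \<times> 'a) set \<Rightarrow> ('a \<times> 'a) set \<Rightarrow> bool" where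
  "chain_congruence P R E \<longleftrightarrow> equiv P E \<and>
     (\<forall>x\<in>P. is_chain_in R (E `` {x})) \<and>
     (\<forall>x\<in>P. \<forall>y\<in>P. strict R x y \<and> (x, y) \<notin> E \<longrightarrow>
         strict R (cls_max R (E `` {x})) (cls_min R (E `` {y})))"

text \<open>Coefficient of x^m in K_{P,E}: number of (P,E)-partitions f : P -> Z_{>0}
  with prod_x x_{f x} = x^m.\<close>
definition K_coeff :: "'a set \<Rightarrow> ('a \<times> 'a) set \<Rightarrow> ('a \<times> 'a) set \<Rightarrow> (nat \<Rightarrow> nat) \<Rightarrow> nat" where
  "K_coeff P R E m = card {f \<in> P \<rightarrow>\<^sub>E {1..}.
      (\<forall>x\<in>P. \<forall>y\<in>P. strict R x y \<longrightarrow> f x \<le> f y) \<and>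
      (\<forall>x\<in>P. \<forall>y\<in>P. (x, y) \<in> E \<longrightarrow> f x = f y) \<and>
      (\<forall>i. card {x\<in>P. f x = i} = m i)}"

definition compositions :: "nat \<Rightarrow> nat list set" where
  "compositions n = {\<alpha>. (\<forall>a\<in>set \<alpha>. 0 < a) \<and> sum_list \<alpha> = n}"

definition Sset :: "nat list \<Rightarrow> nat set" where
  "Sset \<alpha> = {sum_list (take k \<alpha>) | k. 1 \<le> k \<and> k < length \<alpha>}"

definition comp_le :: "nat list \<Rightarrow> nat list \<Rightarrow> bool" where
  "comp_le \<alpha> \<beta> \<longleftrightarrow> Sset \<beta> \<subseteq> Sset \<alpha>"

text \<open>Block B_{i+1}(alpha) (0-indexed i).\<close>
definition block :: "nat list \<Rightarrow> nat \<Rightarrow> nat set" where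
  "block \<alpha> i = {sum_list (take i \<alpha>) + 1 .. sum_list (take (Suc i) \<alpha>)}"

definition pi1 :: "nat list \<Rightarrow> nat" where
  "pi1 \<gamma> = (\<Prod>i<length \<gamma>. sum_list (take (Suc i) \<gamma>))"

definition sub_comp :: "nat list \<Rightarrow> nat list \<Rightarrow> nat \<Rightarrow> nat list" where
  "sub_comp \<alpha> \<beta> j = map (\<lambda>i. \<alpha> ! i) (filter (\<lambda>i. block \<alpha> i \<subseteq> block \<beta> j) [0..<length \<alpha>])"

definition pi2 :: "nat list \<Rightarrow> nat list \<Rightarrow> nat" where
  "pi2 \<alpha> \<beta> = (\<Prod>j<length \<beta>. pi1 (sub_comp \<alpha> \<beta> j))"

definition zee :: "nat list \<Rightarrow> nat" where
  "zee \<alpha> = (\<Prod>i\<in>set \<alpha>. i ^ count_list \<alpha> i * fact (count_list \<alpha> i))"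

definition M_coeff :: "nat list \<Rightarrow> (nat \<Rightarrow> nat) \<Rightarrow> rat" where
  "M_coeff \<beta> m = (if map m (sorted_list_of_set {i. m i \<noteq> 0}) = \<beta> then 1 else 0)"

definition Psi_coeff :: "nat list \<Rightarrow> (nat \<Rightarrow> nat) \<Rightarrow> rat" where
  "Psi_coeff \<alpha> m = of_nat (zee \<alpha>) *
     (\<Sum>\<beta>\<in>{\<beta>\<in>compositions (sum_list \<alpha>). comp_le \<alpha> \<beta>}. M_coeff \<beta> m / of_nat (pi2 \<alpha> \<beta>))"

definition is_minimal :: "('a \<times> 'a) set \<Rightarrow> 'a set \<Rightarrow> 'a \<Rightarrow> bool" where
  "is_minimal R S z \<longleftrightarrow> z \<in> S \<and> \<not> (\<exists>w\<in>S. strict R w z)"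

definition fiber_min :: "('a \<times> 'a) set \<Rightarrow> 'a set \<Rightarrow> ('a \<Rightarrow> nat) \<Rightarrow> nat \<Rightarrow> 'a" where
  "fiber_min R P f i = (THE z. is_minimal R {x\<in>P. f x = i} z)"

definition Ostar :: "'a set \<Rightarrow> ('a \<times> 'a) set \<Rightarrow> ('a \<times> 'a) set \<Rightarrow> nat list \<Rightarrow> ('a \<Rightarrow> nat) set" where
  "Ostar P R E \<alpha> = {f \<in> P \<rightarrow>\<^sub>E {1..length \<alpha>}.
      f ` P = {1..length \<alpha>} \<and>
      (\<forall>x\<in>P. \<forall>y\<in>P. (x, y) \<in> R \<longrightarrow> f x \<le> f y) \<and>
      (\<forall>i\<in>{1..length \<alpha>}. card {x\<in>P. f x = i} = \<alpha> ! (i - 1)) \<and>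
      (\<forall>i\<in>{1..length \<alpha>}. \<exists>!z. is_minimal R {x\<in>P. f x = i} z) \<and>
      (\<forall>x\<in>P. \<forall>y\<in>P. (x, y) \<in> E \<longrightarrow> f x = f y)}"

definition coeffO :: "'a set \<Rightarrow> ('a \<times> 'a) set \<Rightarrow> ('a \<times> 'a) set \<Rightarrow> nat list \<Rightarrow> nat" where
  "coeffO P R E \<alpha> = (\<Sum>f\<in>Ostar P R E \<alpha>. \<Prod>i\<in>{1..length \<alpha>}. card (E `` {fiber_min R P f i}))"

end

theory Submission
  imports Defs
begin

text \<open>
  For a fixed monomial both sides obey the same recursion over the \<open>E\<close>-saturated down-sets
  \<open>D\<close> of \<open>P\<close>. In a partition \<open>f\<close> of weight \<open>m\<close>, whose largest value \<open>k\<close> is attained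
  \<open>b = m k\<close> times, every \<open>x\<close> with \<open>f x = k\<close> drags the whole principal up-set \<open>U x\<close> of
  \<open>min [x]\<close> into the last fibre; counting pairs \<open>(f, x)\<close> gives
  \<open>b * K(D, m) = (\<Sum>x\<in>D. K(D - U x, m'))\<close>, where \<open>m'\<close> lowers the exponent of \<open>x\<^sub>k\<close> by
  \<open>card (U x)\<close> (terms with \<open>card (U x) > b\<close> vanish). On the other side, the last fibre of a map in \<open>O*\<close> has a unique minimal
  element \<open>z\<close>, hence is exactly \<open>U z\<close> with \<open>z\<close> the minimum of its class, and the weight
  \<open>card [z]\<close> turns a sum over such \<open>z\<close> into a sum over all \<open>x\<in>D\<close>; the factor
  \<open>1 / \<pi>(\<alpha>, \<beta>)\<close> loses precisely \<open>1 / b\<close> when the last part of \<open>\<alpha>\<close> is removed.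
\<close>

subsection \<open>Refinement of compositions\<close>

text \<open>
  The lists are reversed compositions, so that recursion removes last parts; the value is
  \<open>1 / \<pi>(\<alpha>, \<beta>)\<close> if \<open>\<alpha> \<le> \<beta>\<close> and \<open>0\<close> otherwise (lemma \<open>refine_wt_rev\<close>).
\<close>
fun refine_wt :: "nat list \<Rightarrow> nat list \<Rightarrow> rat" where
  "refine_wt [] [] = 1"
| "refine_wt (a # as) (b # bs) =
     (if a < b then refine_wt as ((b - a) # bs) / of_nat b
      else if a = b then refine_wt as bs / of_nat b
      else 0)"
| "refine_wt _ _ = 0"

section \<open>Cut points of a composition with a part appended\<close>

lemma Sset_snoc: "Sset (\<alpha> @ [a]) = (if \<alpha> = [] then {} else insert (sum_list \<alpha>) (Sset \<alpha>))"
proof (cases "\<alpha> = []")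
  case True
  then show ?thesis by (auto simp: Sset_def)
next
  case False
  have "s \<in> Sset (\<alpha> @ [a]) \<longleftrightarrow> s \<in> insert (sum_list \<alpha>) (Sset \<alpha>)" for s
  proof
    assume "s \<in> Sset (\<alpha> @ [a])"
    then obtain k where k: "1 \<le> k" "k \<le> length \<alpha>" "s = sum_list (take k \<alpha>)"
      by (auto simp: Sset_def less_Suc_eq_le)
    then show "s \<in> insert (sum_list \<alpha>) (Sset \<alpha>)"
      by (cases "k = length \<alpha>") (auto simp: Sset_def)
  next
    assume "s \<in> insert (sum_list \<alpha>) (Sset \<alpha>)"
    then consider "s = sum_list \<alpha>"
      | k where "1 \<le> k" "k < length \<alpha>" "s = sum_list (take k \<alpha>)"
      by (auto simp: Sset_def)
    then show "s \<in> Sset (\<alpha> @ [a])"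
    proof cases
      case 1
      with False show ?thesis
        unfolding Sset_def by (auto intro!: exI[of _ "length \<alpha>"] simp: Suc_le_eq)
    next
      case 2
      then show ?thesis
        unfolding Sset_def by (auto intro!: exI[of _ k])
    qed
  qed
  with False show ?thesis by auto
qed

lemma Sset_less_sum_list:
  assumes "\<forall>a\<in>set \<alpha>. 0 < a" "s \<in> Sset \<alpha>"
  shows "s < sum_list \<alpha>"
proof -
  obtain k where k: "k < length \<alpha>" "s = sum_list (take k \<alpha>)"
    using assms(2) by (auto simp: Sset_def)
  have "\<alpha> ! k \<in> set (drop k \<alpha>)"
    using k(1) by (metis Cons_nth_drop_Suc list.set_intros(1))
  then have "\<alpha> ! k \<le> sum_list (drop k \<alpha>)"
    by (simp add: member_le_sum_list)
  moreover have "0 < \<alpha> ! k" using assms(1) k(1) by simp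
  moreover have "sum_list \<alpha> = sum_list (take k \<alpha>) + sum_list (drop k \<alpha>)"
    by (metis append_take_drop_id sum_list_append)
  ultimately show ?thesis using k(2) by linarith
qed

text \<open>The cut sets do not see the values of the final parts, only the cuts just before them,
  \<open>sum_list \<alpha>\<close> and \<open>sum_list \<beta>\<close>. For \<open>a = b\<close>
  these cuts coincide and both can be stripped. For \<open>a < b\<close> the cut
  \<open>sum_list \<alpha>\<close> lies above every cut on the coarse side, so deleting it from the
  finer set costs nothing. For \<open>b < a\<close> the cut \<open>sum_list \<beta>\<close> lies
  above every cut of the other composition and inclusion fails.\<close>

lemma comp_le_snoc:
  assumes \<alpha>: "\<forall>x\<in>set \<alpha>. 0 < x" and \<beta>: "\<forall>x\<in>set \<beta>. 0 < x" and "0 < a" "0 < b"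
    and sums: "sum_list \<alpha> + a = sum_list \<beta> + b"
  shows "comp_le (\<alpha> @ [a]) (\<beta> @ [b]) \<longleftrightarrow>
           a < b \<and> comp_le \<alpha> (\<beta> @ [b - a]) \<or> a = b \<and> comp_le \<alpha> \<beta>"
proof -
  have ne: "sum_list \<gamma> = 0 \<longleftrightarrow> \<gamma> = []" if "\<forall>x\<in>set \<gamma>. 0 < x" for \<gamma> :: "nat list"
    using that by (cases \<gamma>) auto
  have lt\<alpha>: "s < sum_list \<alpha>" if "s \<in> Sset \<alpha>" for s
    using Sset_less_sum_list[OF \<alpha> that] .
  have lt\<beta>: "s < sum_list \<beta>" if "s \<in> Sset \<beta>" for s
    using Sset_less_sum_list[OF \<beta> that] .
  consider "a = b" | "a < b" | "b < a" by linarith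
  then show ?thesis
  proof cases
    case 1
    then have s: "sum_list \<alpha> = sum_list \<beta>" using sums by simp
    then have "\<alpha> = [] \<longleftrightarrow> \<beta> = []" using ne[OF \<alpha>] ne[OF \<beta>] by simp
    then show ?thesis using 1 s lt\<alpha> lt\<beta>
      by (auto simp: comp_le_def Sset_snoc subset_iff)
  next
    case 2
    then have less: "sum_list \<beta> < sum_list \<alpha>" using sums by simp
    then have "\<alpha> \<noteq> []" by auto
    moreover have "sum_list \<alpha> \<notin> insert (sum_list \<beta>) (Sset \<beta>)"
      using less lt\<beta>[of "sum_list \<alpha>"] by auto
    ultimately show ?thesis using 2
      by (simp add: comp_le_def Sset_snoc subset_insert)
  next
    case 3
    then have less: "sum_list \<alpha> < sum_list \<beta>" using sums by simp
    then have "\<beta> \<noteq> []" by auto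
    moreover have "sum_list \<beta> \<notin> insert (sum_list \<alpha>) (Sset \<alpha>)"
      using less lt\<alpha>[of "sum_list \<beta>"] by auto
    ultimately show ?thesis using 3
      by (auto simp: comp_le_def Sset_snoc)
  qed
qed

section \<open>Blocks and the products \<pi>\<close>

lemma pi1_snoc: "pi1 (\<gamma> @ [a]) = pi1 \<gamma> * (sum_list \<gamma> + a)"
  by (simp add: pi1_def)

lemma block_snoc: "i < length \<beta> \<Longrightarrow> block (\<beta> @ [b]) i = block \<beta> i"
  by (simp add: block_def Suc_le_eq)

lemma block_last: "block (\<beta> @ [b]) (length \<beta>) = {sum_list \<beta> + 1..sum_list \<beta> + b}"
  by (simp add: block_def)

lemma block_subset_sum: "block \<alpha> i \<subseteq> {..sum_list \<alpha>}"
proof -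
  have "sum_list (take (Suc i) \<alpha>) \<le> sum_list \<alpha>"
    by (metis append_take_drop_id le_add1 sum_list_append)
  then show ?thesis by (auto simp: block_def)
qed

lemma block_nonempty:
  assumes "\<forall>x\<in>set \<alpha>. 0 < x" "i < length \<alpha>"
  shows "block \<alpha> i \<noteq> {}"
proof -
  have "0 < \<alpha> ! i" using assms by simp
  then show ?thesis using assms(2) by (simp add: block_def take_Suc_conv_app_nth)
qed

lemma sub_comp_snoc_left:
  "sub_comp (\<alpha> @ [a]) \<beta> j =
     sub_comp \<alpha> \<beta> j @ (if block (\<alpha> @ [a]) (length \<alpha>) \<subseteq> block \<beta> j then [a] else [])"
proof -
  have "filter (\<lambda>i. block (\<alpha> @ [a]) i \<subseteq> block \<beta> j) [0..<length \<alpha>]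
      = filter (\<lambda>i. block \<alpha> i \<subseteq> block \<beta> j) [0..<length \<alpha>]"
    by (rule filter_cong) (auto simp: block_snoc)
  then show ?thesis by (simp add: sub_comp_def nth_append)
qed

lemma sub_comp_snoc_right: "j < length \<beta> \<Longrightarrow> sub_comp \<alpha> (\<beta> @ [b]) j = sub_comp \<alpha> \<beta> j"
  by (simp add: sub_comp_def block_snoc)

text \<open>The block of \<open>a\<close> contains the common total, which no block before the last
  one of the coarse list reaches. Those earlier blocks do not depend on the final part, hence the
  arbitrary \<open>c\<close>.\<close>

lemma sub_comp_snoc_init:
  assumes "0 < a" "0 < b" "sum_list \<alpha> + a = sum_list \<beta> + b" "j < length \<beta>"
  shows "sub_comp (\<alpha> @ [a]) (\<beta> @ [b]) j = sub_comp \<alpha> (\<beta> @ [c]) j"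
proof -
  have "sum_list \<beta> + b \<in> block (\<alpha> @ [a]) (length \<alpha>)"
    using assms by (simp add: block_last)
  moreover have "sum_list \<beta> + b \<notin> block \<beta> j"
    using block_subset_sum[of \<beta> j] assms(2) by auto
  ultimately have "\<not> block (\<alpha> @ [a]) (length \<alpha>) \<subseteq> block \<beta> j" by blast
  then show ?thesis using assms(4)
    by (simp add: sub_comp_snoc_right sub_comp_snoc_left block_snoc)
qed

text \<open>The blocks of \<open>\<alpha>\<close> end by \<open>sum_list \<beta> + (b - a)\<close>,
  so shortening the last coarse block by \<open>a\<close> does not change which of them it contains.
  For \<open>a = b\<close> the shortened block is empty; \<open>sub_comp_zero\<close> and
  \<open>pi2_zero\<close> handle this degenerate part.\<close>

lemma sub_comp_snoc_last:
  assumes "a \<le> b" "sum_list \<alpha> + a = sum_list \<beta> + b"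
  shows "sub_comp (\<alpha> @ [a]) (\<beta> @ [b]) (length \<beta>) = sub_comp \<alpha> (\<beta> @ [b - a]) (length \<beta>) @ [a]"
proof -
  have "block \<alpha> i \<subseteq> block (\<beta> @ [b]) (length \<beta>) \<longleftrightarrow>
        block \<alpha> i \<subseteq> block (\<beta> @ [b - a]) (length \<beta>)" for i
    using block_subset_sum[of \<alpha> i] assms unfolding block_last subset_iff by fastforce
  then have "sub_comp \<alpha> (\<beta> @ [b]) (length \<beta>) = sub_comp \<alpha> (\<beta> @ [b - a]) (length \<beta>)"
    by (simp add: sub_comp_def)
  moreover have "block (\<alpha> @ [a]) (length \<alpha>) \<subseteq> block (\<beta> @ [b]) (length \<beta>)"
    using assms by (simp add: block_last)
  ultimately show ?thesis by (simp add: sub_comp_snoc_left)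
qed

lemma sub_comp_zero:
  assumes "\<forall>x\<in>set \<alpha>. 0 < x"
  shows "sub_comp \<alpha> (\<beta> @ [0]) (length \<beta>) = []"
  using block_nonempty[OF assms] by (auto simp: sub_comp_def block_last filter_empty_conv)

text \<open>Under refinement the last block is tiled by blocks of \<open>\<alpha>\<close>. The
  induction removes the last tile and shortens the block accordingly, until \<open>a = c\<close>
  exhausts it.\<close>

lemma sum_list_sub_comp_last:
  assumes "\<forall>x\<in>set \<alpha>. 0 < x" "\<forall>x\<in>set \<beta>. 0 < x" "0 < c"
    and "sum_list \<alpha> = sum_list \<beta> + c" "comp_le \<alpha> (\<beta> @ [c])"
  shows "sum_list (sub_comp \<alpha> (\<beta> @ [c]) (length \<beta>)) = c"
  using assms
proof (induction \<alpha> arbitrary: c rule: rev_induct)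
  case Nil
  then show ?case by simp
next
  case (snoc a \<alpha>)
  have sums: "sum_list \<alpha> + a = sum_list \<beta> + c" using snoc.prems by simp
  have pos: "\<forall>x\<in>set \<alpha>. 0 < x" "0 < a" using snoc.prems(1) by auto
  have le: "a < c \<and> comp_le \<alpha> (\<beta> @ [c - a]) \<or> a = c"
    using comp_le_snoc[OF pos(1) snoc.prems(2) pos(2) snoc.prems(3) sums] snoc.prems(5) by blast
  then have "a \<le> c" by auto
  note last = sub_comp_snoc_last[OF this sums]
  from le show ?case
  proof
    assume "a = c"
    then show ?case using last pos by (simp add: sub_comp_zero)
  next
    assume *: "a < c \<and> comp_le \<alpha> (\<beta> @ [c - a])"
    have "sum_list (sub_comp \<alpha> (\<beta> @ [c - a]) (length \<beta>)) = c - a"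
      by (rule snoc.IH) (use * pos snoc.prems sums in auto)
    then show ?case using last * by simp
  qed
qed

text \<open>All factors but the last are untouched, and the last is multiplied by the new total of
  its group. Under refinement this total is \<open>b\<close>, the divisor in
  \<open>refine_wt\<close>.\<close>

lemma pi2_snoc:
  assumes "0 < a" "a \<le> b" "sum_list \<alpha> + a = sum_list \<beta> + b"
  shows "pi2 (\<alpha> @ [a]) (\<beta> @ [b]) =
           pi2 \<alpha> (\<beta> @ [b - a]) * (sum_list (sub_comp \<alpha> (\<beta> @ [b - a]) (length \<beta>)) + a)"
  using assms sub_comp_snoc_init[of a b \<alpha> \<beta> _ "b - a"]
  by (simp add: pi2_def sub_comp_snoc_last pi1_snoc)

lemma pi2_zero:
  assumes "\<forall>x\<in>set \<alpha>. 0 < x"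
  shows "pi2 \<alpha> (\<beta> @ [0]) = pi2 \<alpha> \<beta>"
  using assms by (simp add: pi2_def sub_comp_zero sub_comp_snoc_right pi1_def)

text \<open>In the induction on the last part of \<open>\<alpha>\<close>,
  \<open>comp_le_snoc\<close> produces the branches of the recursion and \<open>pi2_snoc\<close> the
  quotient \<open>b\<close> of successive products.\<close>

lemma refine_wt_rev:
  assumes "\<forall>x\<in>set \<alpha>. 0 < x" "\<forall>x\<in>set \<beta>. 0 < x"
  shows "refine_wt (rev \<alpha>) (rev \<beta>) =
           (if sum_list \<alpha> = sum_list \<beta> \<and> comp_le \<alpha> \<beta> then 1 / of_nat (pi2 \<alpha> \<beta>) else 0)"
  using assms
proof (induction \<alpha> arbitrary: \<beta> rule: rev_induct)
  case Nil
  then show ?case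
    by (cases \<beta> rule: rev_cases) (auto simp: comp_le_def pi2_def)
next
  case (snoc a \<alpha>)
  show ?case
  proof (cases \<beta> rule: rev_cases)
    case Nil
    then show ?thesis using snoc.prems by auto
  next
    case \<beta>: (snoc \<gamma> b)
    have pos: "\<forall>x\<in>set \<alpha>. 0 < x" "0 < a" "\<forall>x\<in>set \<gamma>. 0 < x" "0 < b"
      using snoc.prems \<beta> by auto
    show ?thesis
    proof (cases "sum_list \<alpha> + a = sum_list \<gamma> + b")
      case True
      note le = comp_le_snoc[OF pos(1) pos(3) pos(2) pos(4) True]
      consider "a < b" | "a = b" | "b < a" by linarith
      then show ?thesis
      proof cases
        case 1
        then have IH: "refine_wt (rev \<alpha>) ((b - a) # rev \<gamma>) =
          (if comp_le \<alpha> (\<gamma> @ [b - a]) then 1 / of_nat (pi2 \<alpha> (\<gamma> @ [b - a])) else 0)"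
          using snoc.IH[of "\<gamma> @ [b - a]"] pos True by auto
        show ?thesis
        proof (cases "comp_le \<alpha> (\<gamma> @ [b - a])")
          case c: True
          have "sum_list (sub_comp \<alpha> (\<gamma> @ [b - a]) (length \<gamma>)) = b - a"
            by (rule sum_list_sub_comp_last) (use pos 1 True c in auto)
          then have "pi2 (\<alpha> @ [a]) \<beta> = pi2 \<alpha> (\<gamma> @ [b - a]) * b"
            using pi2_snoc[of a b \<alpha> \<gamma>] 1 pos True \<beta> by simp
          then show ?thesis using 1 IH le c True \<beta> by simp
        qed (use 1 IH le \<beta> in auto)
      next
        case 2
        then have "pi2 (\<alpha> @ [a]) \<beta> = pi2 \<alpha> \<gamma> * b"
          using pi2_snoc[of a b \<alpha> \<gamma>] pos True \<beta> by (simp add: sub_comp_zero pi2_zero)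
        then show ?thesis
          using snoc.IH[of \<gamma>] 2 pos True le \<beta> by simp
      qed (use le \<beta> in auto)
    next
      case False
      \<comment> \<open>Unequal totals stay unequal once \<open>a\<close> is removed on both sides,
        so both sides of the claim are 0.\<close>
      then have "a < b \<Longrightarrow> sum_list \<alpha> \<noteq> sum_list (\<gamma> @ [b - a])"
        and "a = b \<Longrightarrow> sum_list \<alpha> \<noteq> sum_list \<gamma>" by auto
      then show ?thesis
        using False snoc.IH[of "\<gamma> @ [b - a]"] snoc.IH[of \<gamma>] pos \<beta> by auto
    qed
  qed
qed

section \<open>Sums over compositions and coefficients of \<Psi>\<close>

lemma finite_compositions: "finite (compositions n)"
proof (rule finite_subset)
  have "length \<alpha> \<le> sum_list \<alpha>" if "\<forall>a\<in>set \<alpha>. 0 < a" for \<alpha> :: "nat list"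
    using that by (induction \<alpha>) auto
  then show "compositions n \<subseteq> {\<alpha>. set \<alpha> \<subseteq> {..n} \<and> length \<alpha> \<le> n}"
    by (auto simp: compositions_def intro: member_le_sum_list)
  show "finite {\<alpha>. set \<alpha> \<subseteq> {..n} \<and> length \<alpha> \<le> n}"
    by (rule finite_lists_length_le) simp
qed

lemma compositions_0: "compositions 0 = {[]}"
  by (auto simp: compositions_def) (metis list.set_intros(1) neq_Nil_conv not_less_zero)

lemma sum_compositions_snoc:
  assumes "0 < n"
  shows "(\<Sum>\<alpha>\<in>compositions n. F \<alpha>) = (\<Sum>a\<in>{1..n}. \<Sum>\<alpha>\<in>compositions (n - a). F (\<alpha> @ [a]))"
proof -
  have "(\<Sum>a\<in>{1..n}. \<Sum>\<alpha>\<in>compositions (n - a). F (\<alpha> @ [a]))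
      = (\<Sum>(a, \<alpha>)\<in>(SIGMA a:{1..n}. compositions (n - a)). F (\<alpha> @ [a]))"
    by (simp add: sum.Sigma finite_compositions)
  also have "\<dots> = (\<Sum>\<alpha>\<in>compositions n. F \<alpha>)"
  proof (rule sum.reindex_bij_witness[of _ "\<lambda>\<alpha>. (last \<alpha>, butlast \<alpha>)" "\<lambda>(a, \<alpha>). \<alpha> @ [a]"])
    fix \<alpha> assume \<alpha>: "\<alpha> \<in> compositions n"
    then have "\<alpha> \<noteq> []" using assms by (auto simp: compositions_def)
    then obtain \<gamma> a where "\<alpha> = \<gamma> @ [a]" by (cases \<alpha> rule: rev_cases) auto
    with \<alpha> show "(last \<alpha>, butlast \<alpha>) \<in> (SIGMA a:{1..n}. compositions (n - a))"
      "(case (last \<alpha>, butlast \<alpha>) of (a, \<alpha>) \<Rightarrow> \<alpha> @ [a]) = \<alpha>"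
      by (auto simp: compositions_def)
  qed (auto simp: compositions_def)
  finally show ?thesis ..
qed

text \<open>The one composition \<beta> for which the monomial with exponent vector \<open>m\<close>
  occurs in the monomial quasisymmetric function of \<beta>.\<close>

definition wt_of :: "(nat \<Rightarrow> nat) \<Rightarrow> nat list" where
  "wt_of m = map m (sorted_list_of_set {i. m i \<noteq> 0})"

text \<open>The factor \<open>zee \<alpha>\<close> cancels, and only
  \<open>\<beta> = wt_of m\<close> contributes to this coefficient; if it is not a coarsening of
  \<open>\<alpha>\<close> with the same total, both sides vanish.\<close>

lemma Psi_coeff_eq_refine_wt:
  assumes "finite {i. m i \<noteq> 0}" "\<forall>a\<in>set \<alpha>. 0 < a"
  shows "Psi_coeff \<alpha> m / of_nat (zee \<alpha>) = refine_wt (rev \<alpha>) (rev (wt_of m))"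
proof -
  let ?B = "{\<beta> \<in> compositions (sum_list \<alpha>). comp_le \<alpha> \<beta>}"
  have z: "zee \<alpha> \<noteq> 0"
    using assms(2) by (auto simp: zee_def)
  have fin: "finite ?B" using finite_compositions[of "sum_list \<alpha>"] by simp
  have pos: "\<forall>a\<in>set (wt_of m). 0 < a" using assms(1) by (auto simp: wt_of_def)
  have "(\<Sum>\<beta>\<in>?B. M_coeff \<beta> m / of_nat (pi2 \<alpha> \<beta>))
      = (\<Sum>\<beta>\<in>?B. if wt_of m = \<beta> then 1 / of_nat (pi2 \<alpha> \<beta>) else 0)"
    by (rule sum.cong) (auto simp: M_coeff_def wt_of_def)
  also have "\<dots> = (if wt_of m \<in> ?B then 1 / of_nat (pi2 \<alpha> (wt_of m)) else 0)"
    using fin by simp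
  also have "\<dots> = refine_wt (rev \<alpha>) (rev (wt_of m))"
    using pos by (simp add: refine_wt_rev[OF assms(2) pos] compositions_def eq_commute)
  finally show ?thesis using z by (simp add: Psi_coeff_def)
qed

lemma sorted_list_of_set_insert_greater:
  fixes k :: "'b::linorder"
  assumes "finite S" "\<forall>x\<in>S. x < k"
  shows "sorted_list_of_set (insert k S) = sorted_list_of_set S @ [k]"
proof (rule sorted_distinct_set_unique)
  show "sorted (sorted_list_of_set S @ [k])" "distinct (sorted_list_of_set S @ [k])"
    using assms by (auto simp: sorted_append intro: less_imp_le)
qed (use assms in \<open>simp_all del: sorted_list_of_set_insert_remove\<close>)

text \<open>The exponent at the largest index \<open>k\<close> of the support heads the reversed
  list. Lowering it changes only the head, and lowering it to 0 deletes the head; these are the two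
  nonzero branches of \<open>refine_wt\<close>.\<close>

lemma rev_wt_of_Max:
  assumes fin: "finite {i. m i \<noteq> 0}" and k: "m k \<noteq> 0" "\<forall>i. m i \<noteq> 0 \<longrightarrow> i \<le> k"
  shows "rev (wt_of m) = m k # rev (wt_of (m(k := 0)))"
    and "0 < c \<Longrightarrow> rev (wt_of (m(k := c))) = c # rev (wt_of (m(k := 0)))"
proof -
  have *: "rev (wt_of p) = p k # rev (wt_of (m(k := 0)))"
    if p: "p k \<noteq> 0" "\<And>i. i \<noteq> k \<Longrightarrow> p i = m i" for p
  proof -
    let ?S = "{i. (m(k := 0)) i \<noteq> 0}"
    have S: "{i. p i \<noteq> 0} = insert k ?S" using p by auto
    have finS: "finite ?S" using fin by (rule rev_finite_subset) auto
    have lt: "\<forall>x\<in>?S. x < k"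
    proof
      fix x assume "x \<in> ?S"
      then have "m x \<noteq> 0" "x \<noteq> k" by (auto split: if_splits)
      with k(2)[rule_format, of x] show "x < k" by linarith
    qed
    have "sorted_list_of_set (insert k ?S) = sorted_list_of_set ?S @ [k]"
      using finS lt by (rule sorted_list_of_set_insert_greater)
    moreover have "map p (sorted_list_of_set ?S) = map (m(k := 0)) (sorted_list_of_set ?S)"
      using finS p by (intro map_cong) auto
    ultimately show ?thesis unfolding wt_of_def S by simp
  qed
  show "rev (wt_of m) = m k # rev (wt_of (m(k := 0)))"
    by (rule *) (use k(1) in simp_all)
  show "0 < c \<Longrightarrow> rev (wt_of (m(k := c))) = c # rev (wt_of (m(k := 0)))"
    using *[of "m(k := c)"] by (simp only: fun_upd_apply) simp
qed

subsection \<open>Chain congruences\<close>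

definition K_maps :: "'a set \<Rightarrow> ('a \<times> 'a) set \<Rightarrow> ('a \<times> 'a) set \<Rightarrow> (nat \<Rightarrow> nat) \<Rightarrow> ('a \<Rightarrow> nat) set" where
  "K_maps P R E m = {f \<in> P \<rightarrow>\<^sub>E {1..}.
      (\<forall>x\<in>P. \<forall>y\<in>P. strict R x y \<longrightarrow> f x \<le> f y) \<and>
      (\<forall>x\<in>P. \<forall>y\<in>P. (x, y) \<in> E \<longrightarrow> f x = f y) \<and>
      (\<forall>i. card {x\<in>P. f x = i} = m i)}"

lemma K_coeff_eq_card: "K_coeff P R E m = card (K_maps P R E m)"
  by (simp add: K_coeff_def K_maps_def)

lemma K_maps_value:
  assumes "finite D" "f \<in> K_maps D R E m" "x \<in> D"
  shows "m (f x) \<noteq> 0"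
proof -
  have "card {y\<in>D. f y = f x} = m (f x)" using assms(2) by (simp add: K_maps_def)
  moreover have "card {y\<in>D. f y = f x} \<noteq> 0" using assms(1,3) by (auto simp: card_eq_0_iff)
  ultimately show ?thesis by simp
qed

lemma finite_K_maps:
  assumes "finite D" "finite {i. m i \<noteq> 0}"
  shows "finite (K_maps D R E m)"
proof (rule finite_subset)
  show "K_maps D R E m \<subseteq> D \<rightarrow>\<^sub>E {i. m i \<noteq> 0}"
  proof
    fix f assume f: "f \<in> K_maps D R E m"
    then show "f \<in> D \<rightarrow>\<^sub>E {i. m i \<noteq> 0}"
      using K_maps_value[OF assms(1) f] by (simp add: K_maps_def PiE_iff)
  qed
  show "finite (D \<rightarrow>\<^sub>E {i. m i \<noteq> 0})" using assms by (intro finite_PiE) auto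
qed

lemma OstarI:
  assumes "f \<in> D \<rightarrow>\<^sub>E {1..length \<alpha>}" "f ` D = {1..length \<alpha>}"
    and "\<And>x y. x \<in> D \<Longrightarrow> y \<in> D \<Longrightarrow> (x, y) \<in> R \<Longrightarrow> f x \<le> f y"
    and "\<And>x y. x \<in> D \<Longrightarrow> y \<in> D \<Longrightarrow> (x, y) \<in> E \<Longrightarrow> f x = f y"
    and "\<And>i. i \<in> {1..length \<alpha>} \<Longrightarrow> card {x\<in>D. f x = i} = \<alpha> ! (i - 1)"
    and "\<And>i. i \<in> {1..length \<alpha>} \<Longrightarrow> \<exists>!z. is_minimal R {x\<in>D. f x = i} z"
  shows "f \<in> Ostar D R E \<alpha>"
  unfolding Ostar_def by (intro CollectI conjI ballI impI assms)

lemma Ostar_fiber: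
  assumes "f \<in> Ostar D R E \<alpha>" "i \<in> {1..length \<alpha>}"
  shows "card {x\<in>D. f x = i} = \<alpha> ! (i - 1)" "\<exists>!z. is_minimal R {x\<in>D. f x = i} z"
  using assms unfolding Ostar_def by blast+

lemma finite_Ostar: "finite D \<Longrightarrow> finite (Ostar D R E \<alpha>)"
  by (rule finite_subset[OF _ finite_PiE[of D "\<lambda>_. {1..length \<alpha>}"]]) (auto simp: Ostar_def)

section \<open>Minimal elements and the extrema of classes\<close>

locale chain_congruence_poset =
  fixes P :: "'a set" and R E :: "('a \<times> 'a) set"
  assumes finite_P: "finite P"
    and partial_order: "partial_order_on P R"
    and chain_cong: "chain_congruence P R E"
begin

lemma R_carrier: "R \<subseteq> P \<times> P" and refl_R: "refl_on P R" and trans_R: "trans R" and antisym_R: "antisym R"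
  using partial_order by (simp_all add: partial_order_on_def preorder_on_def)

lemmas R_refl = refl_onD[OF refl_R]
  and R_trans = transD[OF trans_R]
  and R_antisym = antisymD[OF antisym_R]

lemma equiv_E: "equiv P E"
  using chain_cong by (simp add: chain_congruence_def)

lemma E_subset: "E \<subseteq> P \<times> P" and refl_E: "refl_on P E" and sym_E: "sym E" and trans_E: "trans E"
  using equiv_E by (simp_all add: equiv_def)

lemma E_carrier: "(x, y) \<in> E \<Longrightarrow> x \<in> P \<and> y \<in> P"
  using E_subset by blast

lemmas E_refl = refl_onD[OF refl_E]
  and E_sym = symD[OF sym_E]
  and E_trans = transD[OF trans_E]

text \<open>By finiteness the part of \<open>F\<close> below \<open>y\<close> has a minimal element;
  transitivity makes it minimal in all of \<open>F\<close>.\<close>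

lemma ex_minimal_below:
  assumes "F \<subseteq> P" "y \<in> F"
  shows "\<exists>w. is_minimal R F w \<and> (w, y) \<in> R"
proof -
  let ?B = "{v\<in>F. (v, y) \<in> R}"
  have "\<exists>w\<in>?B. \<forall>x\<in>?B. x \<noteq> w \<longrightarrow> \<not> strict R x w"
  proof (rule Finite_Set.bex_min_element)
    show "finite ?B" using assms finite_P by (auto intro: finite_subset)
    show "?B \<noteq> {}" using assms R_refl by auto
    show "asymp_on ?B (strict R)"
      by (auto simp: asymp_on_def strict_def dest: R_antisym)
    show "transp_on ?B (strict R)"
      by (auto simp: transp_on_def strict_def dest: R_antisym intro: R_trans)
  qed
  then obtain w where w: "w \<in> F" "(w, y) \<in> R"
    "\<And>x. x \<in> F \<Longrightarrow> (x, y) \<in> R \<Longrightarrow> \<not> strict R x w"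
    by (auto simp: strict_def)
  moreover have "\<not> strict R x w" if "x \<in> F" for x
    using w that R_trans unfolding strict_def by blast
  ultimately show ?thesis by (auto simp: is_minimal_def)
qed

definition rep :: "'a \<Rightarrow> 'a" where
  "rep x = cls_min R (E `` {x})"

lemma class_chain: "x \<in> P \<Longrightarrow> a \<in> E `` {x} \<Longrightarrow> b \<in> E `` {x} \<Longrightarrow> (a, b) \<in> R \<or> (b, a) \<in> R"
  using chain_cong by (auto simp: chain_congruence_def is_chain_in_def)

lemma cls_min_props:
  assumes "x \<in> P"
  shows "cls_min R (E `` {x}) \<in> E `` {x} \<and> (\<forall>w\<in>E `` {x}. (cls_min R (E `` {x}), w) \<in> R)"
proof -
  have sub: "E `` {x} \<subseteq> P" and x: "x \<in> E `` {x}"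
    using E_carrier E_refl assms by blast+
  obtain z where z: "is_minimal R (E `` {x}) z"
    using ex_minimal_below[OF sub x] by auto
  have "(z, w) \<in> R" if "w \<in> E `` {x}" for w
    using z that class_chain[OF assms, of z w] by (auto simp: is_minimal_def strict_def)
  with z have "\<exists>z. z \<in> E `` {x} \<and> (\<forall>w\<in>E `` {x}. (z, w) \<in> R)"
    by (auto simp: is_minimal_def)
  then have "\<exists>!z. z \<in> E `` {x} \<and> (\<forall>w\<in>E `` {x}. (z, w) \<in> R)"
    using R_antisym by blast
  then show ?thesis unfolding cls_min_def by (rule theI')
qed

lemma rep_E: "x \<in> P \<Longrightarrow> (x, rep x) \<in> E"
  using cls_min_props by (auto simp: rep_def)

lemma rep_le: "(x, y) \<in> E \<Longrightarrow> (rep x, y) \<in> R"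
  using cls_min_props E_carrier by (auto simp: rep_def)

lemma rep_eq: "(x, y) \<in> E \<Longrightarrow> rep x = rep y"
  using equiv_class_eq[OF equiv_E] by (auto simp: rep_def)

lemma rep_rep: "x \<in> P \<Longrightarrow> rep (rep x) = rep x"
  using rep_E rep_eq by metis

text \<open>In a finite chain a maximal element is the maximum, and antisymmetry makes it unique, so
  the description in \<open>cls_max\<close> denotes it.\<close>

lemma cls_max_ge:
  assumes "(x, w) \<in> E"
  shows "(w, cls_max R (E `` {x})) \<in> R"
proof -
  have x: "x \<in> P" using assms E_carrier by blast
  let ?C = "E `` {x}"
  have "\<exists>z\<in>?C. \<forall>v\<in>?C. v \<noteq> z \<longrightarrow> \<not> strict R z v"
  proof (rule Finite_Set.bex_max_element)
    show "finite ?C" using E_carrier finite_P by (auto intro: finite_subset)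
    show "?C \<noteq> {}" using E_refl[OF x] by auto
    show "asymp_on ?C (strict R)"
      by (auto simp: asymp_on_def strict_def dest: R_antisym)
    show "transp_on ?C (strict R)"
      by (auto simp: transp_on_def strict_def dest: R_antisym intro: R_trans)
  qed
  then obtain z where z: "z \<in> ?C" "\<And>v. v \<in> ?C \<Longrightarrow> v \<noteq> z \<Longrightarrow> \<not> strict R z v" by blast
  have "(v, z) \<in> R" if "v \<in> ?C" for v
    using z(2)[OF that] class_chain[OF x z(1) that] unfolding strict_def by auto
  with z(1) have "\<exists>z. z \<in> ?C \<and> (\<forall>v\<in>?C. (v, z) \<in> R)" by blast
  then have "\<exists>!z. z \<in> ?C \<and> (\<forall>v\<in>?C. (v, z) \<in> R)"
    using R_antisym by blast
  then have "cls_max R ?C \<in> ?C \<and> (\<forall>v\<in>?C. (v, cls_max R ?C) \<in> R)"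
    unfolding cls_max_def by (rule theI')
  then show ?thesis using assms by blast
qed

text \<open>Principal up-sets of class minima are saturated. If \<open>y\<close> lies in the class
  of \<open>x\<close>, so does \<open>w\<close>; otherwise the separation condition puts the maximum
  of that class below the minimum of the class of \<open>y\<close>, hence below
  \<open>w\<close>.\<close>

lemma rep_le_E:
  assumes x: "x \<in> P" and le: "(rep x, y) \<in> R" and yw: "(y, w) \<in> E"
  shows "(rep x, w) \<in> R"
proof (cases "(rep x, y) \<in> E")
  case True
  then show ?thesis using yw x E_trans rep_E rep_le by blast
next
  case False
  have P: "rep x \<in> P" "y \<in> P" using x yw E_carrier rep_E by blast+
  with False have "strict R (rep x) y" using le E_refl by (auto simp: strict_def)
  with P False chain_cong have "strict R (cls_max R (E `` {rep x})) (rep y)"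
    unfolding chain_congruence_def rep_def by blast
  then have "(cls_max R (E `` {rep x}), rep y) \<in> R" by (simp add: strict_def)
  moreover have "(rep x, cls_max R (E `` {rep x})) \<in> R"
    by (rule cls_max_ge) (rule E_refl[OF P(1)])
  ultimately show ?thesis using rep_le[OF yw] R_trans by blast
qed

section \<open>Saturated down-sets and principal up-sets\<close>

text \<open>Closure under \<open>E\<close> keeps classes whole, so classes and their minima taken in
  \<open>P\<close> serve every subposet met by the recursion, and \<open>R\<close> and
  \<open>E\<close> are never restricted.\<close>

definition ideal :: "'a set \<Rightarrow> bool" where
  "ideal D \<longleftrightarrow> D \<subseteq> P \<and> (\<forall>y\<in>D. \<forall>x. (x, y) \<in> R \<or> (x, y) \<in> E \<longrightarrow> x \<in> D)"

text \<open>Starting from \<open>rep x\<close> makes this set depend only on the class of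
  \<open>x\<close>.\<close>

definition up :: "'a set \<Rightarrow> 'a \<Rightarrow> 'a set" where
  "up D x = {y\<in>D. (rep x, y) \<in> R}"

lemma ideal_P: "ideal P"
  using R_carrier E_subset unfolding ideal_def by blast

lemma ideal_subset: "ideal D \<Longrightarrow> D \<subseteq> P"
  by (simp add: ideal_def)

lemma ideal_carrier: "ideal D \<Longrightarrow> x \<in> D \<Longrightarrow> x \<in> P"
  using ideal_subset by blast

lemma ideal_R: "ideal D \<Longrightarrow> y \<in> D \<Longrightarrow> (x, y) \<in> R \<Longrightarrow> x \<in> D"
  unfolding ideal_def by blast

lemma ideal_E: "ideal D \<Longrightarrow> y \<in> D \<Longrightarrow> (x, y) \<in> E \<Longrightarrow> x \<in> D"
  unfolding ideal_def by blast

lemma ideal_finite: "ideal D \<Longrightarrow> finite D"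
  using finite_subset[OF ideal_subset finite_P] .

lemma ideal_rep: "ideal D \<Longrightarrow> x \<in> D \<Longrightarrow> rep x \<in> D"
  by (rule ideal_E[OF _ _ E_sym[OF rep_E[OF ideal_carrier]]])

lemma up_subset: "up D x \<subseteq> D"
  by (auto simp: up_def)

lemma up_self: "ideal D \<Longrightarrow> x \<in> D \<Longrightarrow> x \<in> up D x"
  using rep_le[OF E_refl[OF ideal_carrier]] by (simp add: up_def)

lemma up_E_iff:
  assumes "ideal D" "x \<in> D" "(y, w) \<in> E"
  shows "y \<in> up D x \<longleftrightarrow> w \<in> up D x"
proof -
  have x: "x \<in> P" using ideal_carrier[OF assms(1,2)] .
  have "y \<in> D \<longleftrightarrow> w \<in> D"
    using ideal_E[OF assms(1) _ assms(3)] ideal_E[OF assms(1) _ E_sym[OF assms(3)]] by blast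
  then show ?thesis
    using rep_le_E[OF x _ assms(3)] rep_le_E[OF x _ E_sym[OF assms(3)]] by (auto simp: up_def)
qed

lemma up_R: "y \<in> up D x \<Longrightarrow> w \<in> D \<Longrightarrow> (y, w) \<in> R \<Longrightarrow> w \<in> up D x"
  using R_trans by (auto simp: up_def)

lemma ideal_diff_up:
  assumes "ideal D" "x \<in> D"
  shows "ideal (D - up D x)"
  unfolding ideal_def
proof (intro conjI ballI allI impI)
  show "D - up D x \<subseteq> P" using ideal_subset[OF assms(1)] by blast
next
  fix y w assume y: "y \<in> D - up D x" and w: "(w, y) \<in> R \<or> (w, y) \<in> E"
  have "w \<in> D" using w y ideal_R[OF assms(1)] ideal_E[OF assms(1)] by blast
  moreover have "w \<notin> up D x"
    using w y up_R[of w D x y] up_E_iff[OF assms, of w y] by blast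
  ultimately show "w \<in> D - up D x" by simp
qed

lemma card_diff_up:
  assumes "ideal D" "x \<in> D"
  shows "card (D - up D x) = card D - card (up D x)" "0 < card (up D x)" "card (up D x) \<le> card D"
proof -
  have fin: "finite (up D x)" by (rule finite_subset[OF up_subset ideal_finite[OF assms(1)]])
  show "card (D - up D x) = card D - card (up D x)"
    using fin up_subset by (rule card_Diff_subset)
  show "0 < card (up D x)" using fin up_self[OF assms] by (auto simp: card_gt_0_iff)
  show "card (up D x) \<le> card D"
    by (rule card_mono) (use ideal_finite[OF assms(1)] up_subset in auto)
qed

section \<open>Recursion for the coefficients of K\<close>

text \<open>A map with \<open>f x = k\<close> is forced to equal \<open>k\<close> on
  \<open>U\<close>, so it is determined by its restriction to \<open>D - U\<close>; conversely every
  map counted there extends by the top value \<open>k\<close>. If \<open>U\<close> has more than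
  \<open>m k\<close> elements, the fibre over \<open>k\<close> cannot hold it.\<close>

lemma card_K_maps_fiber:
  assumes D: "ideal D" "x \<in> D" and k: "m k \<noteq> 0" "\<forall>i. m i \<noteq> 0 \<longrightarrow> i \<le> k" and m0: "m 0 = 0"
  defines "U \<equiv> up D x"
  shows "card {f \<in> K_maps D R E m. f x = k} =
    (if card U \<le> m k then card (K_maps (D - U) R E (m(k := m k - card U))) else 0)"
proof -
  note fin = ideal_finite[OF D(1)]
  have UD: "U \<subseteq> D" using up_subset by (simp add: U_def)
  have finU: "finite U" by (rule finite_subset[OF UD fin])
  have kpos: "1 \<le> k" using k(1) m0 by (cases k) auto
  have xP: "x \<in> P" using ideal_carrier[OF D] .
  have xU: "x \<in> U" using up_self[OF D] by (simp add: U_def)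
  have onU: "f y = k" if f: "f \<in> K_maps D R E m" "f x = k" and y: "y \<in> U" for f y
  proof -
    have yD: "y \<in> D" and ry: "(rep x, y) \<in> R" using y by (auto simp: U_def up_def)
    \<comment> \<open>\<open>f\<close> is constant on the class of \<open>x\<close> and monotone, so
      \<open>f y\<close> is at least \<open>k\<close>; it is at most \<open>k\<close> because every
      value lies in the support of \<open>m\<close>.\<close>
    have "f (rep x) = k"
      using f D ideal_rep[OF D] rep_E[OF xP] by (auto simp: K_maps_def)
    moreover have "f (rep x) \<le> f y"
      using f ry yD ideal_rep[OF D] by (cases "rep x = y") (auto simp: K_maps_def strict_def)
    moreover have "f y \<le> k" by (rule k(2)[rule_format]) (rule K_maps_value[OF fin f(1) yD])
    ultimately show ?thesis by simp
  qed
  show ?thesis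
  proof (cases "card U \<le> m k")
    case False
    have "U \<subseteq> {y\<in>D. f y = k}" if "f \<in> K_maps D R E m" "f x = k" for f
      using onU[OF that] UD by auto
    then have "card U \<le> m k" if "f \<in> K_maps D R E m" "f x = k" for f
      using that card_mono[of "{y\<in>D. f y = k}" U] fin by (auto simp: K_maps_def)
    with False have "{f \<in> K_maps D R E m. f x = k} = {}" by auto
    then show ?thesis using False by (simp only: card.empty if_False)
  next
    case True
    let ?m = "m(k := m k - card U)"
    let ?r = "\<lambda>f. restrict f (D - U)"
    let ?e = "\<lambda>g. \<lambda>y\<in>D. if y \<in> U then k else g y"
    have "bij_betw ?r {f \<in> K_maps D R E m. f x = k} (K_maps (D - U) R E ?m)"
    proof (rule bij_betw_byWitness[where f' = ?e])
      show "\<forall>f\<in>{f \<in> K_maps D R E m. f x = k}. ?e (?r f) = f"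
      proof (intro ballI ext)
        fix f y assume "f \<in> {f \<in> K_maps D R E m. f x = k}"
        then show "?e (?r f) y = f y"
          using onU[of f y] by (auto simp: K_maps_def PiE_iff extensional_def)
      qed
      show "\<forall>g\<in>K_maps (D - U) R E ?m. ?r (?e g) = g"
      proof (intro ballI ext)
        fix g y assume "g \<in> K_maps (D - U) R E ?m"
        then show "?r (?e g) y = g y"
          by (auto simp: K_maps_def PiE_iff extensional_def)
      qed
      show "?r ` {f \<in> K_maps D R E m. f x = k} \<subseteq> K_maps (D - U) R E ?m"
      proof (rule image_subsetI)
        fix f assume "f \<in> {f \<in> K_maps D R E m. f x = k}"
        then have f: "f \<in> K_maps D R E m" "f x = k" by simp_all
        have "card {y\<in>D - U. ?r f y = i} = ?m i" for i
        proof -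
          have eq: "{y\<in>D - U. ?r f y = i} = {y\<in>D. f y = i} - {y\<in>U. f y = i}" by auto
          have "card {y\<in>D. f y = i} = m i" using f(1) by (simp add: K_maps_def)
          then have "card {y\<in>D - U. ?r f y = i} = m i - card {y\<in>U. f y = i}"
            unfolding eq using UD finU by (subst card_Diff_subset) auto
          moreover have "{y\<in>U. f y = i} = (if i = k then U else {})"
            using onU[OF f(1) f(2)] by auto
          ultimately show ?thesis by simp
        qed
        then show "?r f \<in> K_maps (D - U) R E ?m"
          using f(1) unfolding K_maps_def by (auto simp: PiE_iff)
      qed
      show "?e ` K_maps (D - U) R E ?m \<subseteq> {f \<in> K_maps D R E m. f x = k}"
      proof (rule image_subsetI)
        fix g assume g: "g \<in> K_maps (D - U) R E ?m"
        have gk: "g y \<le> k" if "y \<in> D - U" for y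
          using K_maps_value[OF _ g that] fin k(2)[rule_format, of "g y"] by (auto split: if_splits)
        have "card {y\<in>D. ?e g y = i} = m i" for i
        proof -
          have eq: "{y\<in>D. ?e g y = i} = {y\<in>D - U. g y = i} \<union> (if i = k then U else {})"
            using UD by auto
          have "card {y\<in>D - U. g y = i} = ?m i" using g by (simp add: K_maps_def)
          \<comment> \<open>At \<open>i = k\<close> the assumption \<open>card U \<le> m k\<close>
            makes the truncated subtraction exact.\<close>
          then show ?thesis unfolding eq using True fin finU
            by (subst card_Un_disjoint) auto
        qed
        moreover have "?e g y \<le> ?e g w" if "y \<in> D" "w \<in> D" "strict R y w" for y w
        \<comment> \<open>For \<open>w\<close> in \<open>U\<close> the right side is the largest
          value \<open>k\<close>; otherwise upward closure of \<open>U\<close> keeps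
          \<open>y\<close> out as well, and \<open>g\<close> decides.\<close>
        proof (cases "w \<in> U")
          case True
          then show ?thesis using gk that by simp
        next
          case False
          then have "y \<notin> U" using up_R that unfolding U_def strict_def by blast
          then show ?thesis using False that g by (auto simp: K_maps_def)
        qed
        moreover have "?e g y = ?e g w" if "y \<in> D" "w \<in> D" "(y, w) \<in> E" for y w
          using up_E_iff[OF D that(3)] that g unfolding U_def[symmetric]
          by (auto simp: K_maps_def)
        moreover have "?e g \<in> D \<rightarrow>\<^sub>E {1..}"
          using g kpos by (auto simp: K_maps_def)
        ultimately show "?e g \<in> {f \<in> K_maps D R E m. f x = k}"
          using xU D(2) by (simp add: K_maps_def)
      qed
    qed
    then show ?thesis using True bij_betw_same_card by (simp only: if_True) blast
  qed
qed

lemma K_coeff_rec: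
  assumes D: "ideal D" and fm: "finite {i. m i \<noteq> 0}"
    and k: "m k \<noteq> 0" "\<forall>i. m i \<noteq> 0 \<longrightarrow> i \<le> k" and m0: "m 0 = 0"
  shows "m k * K_coeff D R E m =
    (\<Sum>x\<in>D. if card (up D x) \<le> m k
            then K_coeff (D - up D x) R E (m(k := m k - card (up D x))) else 0)"
proof -
  note fin = ideal_finite[OF D]
  have "m k * K_coeff D R E m = (\<Sum>f\<in>K_maps D R E m. m k)"
    by (simp add: K_coeff_eq_card)
  \<comment> \<open>\<open>m k\<close> is the size of the fibre over \<open>k\<close>, so the sum
    counts pairs \<open>(f, x)\<close> with \<open>f x = k\<close>; the next step counts them by
    \<open>x\<close>.\<close>
  also have "\<dots> = (\<Sum>f\<in>K_maps D R E m. \<Sum>x\<in>{x\<in>D. f x = k}. 1)"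
    by (rule sum.cong) (auto simp: K_maps_def)
  also have "\<dots> = (\<Sum>x\<in>D. \<Sum>f\<in>{f \<in> K_maps D R E m. f x = k}. 1)"
    using finite_K_maps[OF fin fm] fin by (rule sum.swap_restrict)
  also have "\<dots> = (\<Sum>x\<in>D. card {f \<in> K_maps D R E m. f x = k})" by simp
  also have "\<dots> = (\<Sum>x\<in>D. if card (up D x) \<le> m k
            then K_coeff (D - up D x) R E (m(k := m k - card (up D x))) else 0)"
    unfolding K_coeff_eq_card by (rule sum.cong[OF refl]) (rule card_K_maps_fiber[OF D _ k m0])
  finally show ?thesis .
qed

section \<open>Recursion for the maps with unique fibre minima\<close>

text \<open>The last fibre contains \<open>rep z\<close> because \<open>f\<close> is constant on
  classes, so minimality forces \<open>rep z = z\<close>. Each element of the fibre lies above a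
  minimal one, which can only be \<open>z\<close>; conversely everything in \<open>D\<close> above
  \<open>z\<close> takes at least the value \<open>f z\<close>, already the largest.\<close>

lemma Ostar_last_fiber:
  assumes D: "ideal D" and f: "f \<in> Ostar D R E (\<alpha> @ [a])"
  defines "z \<equiv> fiber_min R D f (Suc (length \<alpha>))"
  shows "z \<in> D" "rep z = z" "{x\<in>D. f x = Suc (length \<alpha>)} = up D z" "card (up D z) = a"
proof -
  let ?F = "{x\<in>D. f x = Suc (length \<alpha>)}"
  have FP: "?F \<subseteq> P" using ideal_subset[OF D] by blast
  have ex1: "\<exists>!z. is_minimal R ?F z" using f by (auto simp: Ostar_def)
  have z: "is_minimal R ?F z"
    unfolding z_def fiber_min_def by (rule theI'[OF ex1])
  then show zD: "z \<in> D" by (simp add: is_minimal_def)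
  then have zP: "z \<in> P" by (rule ideal_carrier[OF D])
  have "f (rep z) = f z"
    using f zD ideal_rep[OF D zD] E_sym[OF rep_E[OF zP]] by (auto simp: Ostar_def)
  then have "rep z \<in> ?F" using z ideal_rep[OF D zD] by (simp add: is_minimal_def)
  then show rz: "rep z = z"
    using z rep_le[OF E_refl[OF zP]] by (auto simp: is_minimal_def strict_def)
  show F: "?F = up D z"
  proof
    show "?F \<subseteq> up D z"
    proof
      fix y assume y: "y \<in> ?F"
      then obtain w where "is_minimal R ?F w" "(w, y) \<in> R"
        using ex_minimal_below[OF FP] by blast
      then show "y \<in> up D z" using ex1 z y by (auto simp: up_def rz)
    qed
    show "up D z \<subseteq> ?F"
    proof
      fix y assume y: "y \<in> up D z"
      then have "f z \<le> f y" "f y \<le> Suc (length \<alpha>)" "y \<in> D"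
        using f zD by (auto simp: up_def rz Ostar_def PiE_iff)
      then show "y \<in> ?F" using z by (simp add: is_minimal_def)
    qed
  qed
  have "card ?F = (\<alpha> @ [a]) ! (Suc (length \<alpha>) - 1)"
    using f by (auto simp only: Ostar_def mem_Collect_eq length_append_singleton)
       (auto simp: Ball_def)
  then show "card (up D z) = a" by (simp add: F)
qed

text \<open>The lower fibres are the same sets before and after removal of the last one, so sizes
  and unique minima carry over; the second claim later transfers \<open>fiber_min\<close>.\<close>

lemma Ostar_restrict:
  assumes D: "ideal D" and f: "f \<in> Ostar D R E (\<alpha> @ [a])"
  defines "z \<equiv> fiber_min R D f (Suc (length \<alpha>))"
  shows "restrict f (D - up D z) \<in> Ostar (D - up D z) R E \<alpha>"
    and "\<And>i. i \<le> length \<alpha> \<Longrightarrow> {x\<in>D - up D z. restrict f (D - up D z) x = i} = {x\<in>D. f x = i}"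
proof -
  let ?D = "D - up D z"
  note F = Ostar_last_fiber(3)[OF D f, folded z_def]
  have U: "x \<in> up D z \<longleftrightarrow> x \<in> D \<and> f x = Suc (length \<alpha>)" for x by (simp add: F[symmetric])
  show fib: "{x\<in>?D. restrict f ?D x = i} = {x\<in>D. f x = i}" if "i \<le> length \<alpha>" for i
    using that by (auto simp: U)
  have range: "f x \<in> {1..length \<alpha>}" if "x \<in> ?D" for x
    using that f by (auto simp: U Ostar_def PiE_iff le_Suc_eq)
  have surj: "\<exists>x\<in>?D. f x = i" if i: "i \<in> {1..length \<alpha>}" for i
  proof -
    have "i \<in> f ` D" using f i by (auto simp: Ostar_def)
    then show ?thesis using i by (force simp: U)
  qed
  show "restrict f ?D \<in> Ostar ?D R E \<alpha>"
  proof (rule OstarI)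
    show "restrict f ?D \<in> ?D \<rightarrow>\<^sub>E {1..length \<alpha>}"
      using range by (simp add: PiE_iff)
    show "restrict f ?D ` ?D = {1..length \<alpha>}"
      using range surj by (force simp: image_iff)
  next
    fix x y assume "x \<in> ?D" "y \<in> ?D" "(x, y) \<in> R"
    then show "restrict f ?D x \<le> restrict f ?D y" using f by (simp add: Ostar_def)
  next
    fix x y assume "x \<in> ?D" "y \<in> ?D" "(x, y) \<in> E"
    then show "restrict f ?D x = restrict f ?D y" using f by (simp add: Ostar_def)
  next
    fix i assume i: "i \<in> {1..length \<alpha>}"
    then have "i \<in> {1..length (\<alpha> @ [a])}" by simp
    note this = Ostar_fiber[OF f this]
    moreover have "i - 1 < length \<alpha>" using i by (auto simp: less_Suc_eq_le[symmetric])
    moreover have "{x\<in>?D. restrict f ?D x = i} = {x\<in>D. f x = i}" using i by (intro fib) simp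
    ultimately show "card {x\<in>?D. restrict f ?D x = i} = \<alpha> ! (i - 1)"
      "\<exists>!z. is_minimal R {x\<in>?D. restrict f ?D x = i} z"
      by (simp_all only: nth_append if_True)
  qed
qed

text \<open>This inverts the removal of the last fibre. Upward closure and saturation of
  \<open>up D z\<close> give monotonicity and compatibility with \<open>E\<close>, and
  \<open>rep z = z\<close> makes \<open>z\<close> its only minimal element.\<close>

lemma Ostar_extend:
  assumes D: "ideal D" and z: "z \<in> D" "rep z = z"
    and g: "g \<in> Ostar (D - up D z) R E \<alpha>"
  defines "f \<equiv> \<lambda>x\<in>D. if x \<in> up D z then Suc (length \<alpha>) else g x"
  shows "f \<in> Ostar D R E (\<alpha> @ [card (up D z)])"
    and "fiber_min R D f (Suc (length \<alpha>)) = z"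
proof -
  let ?D = "D - up D z"
  have zU: "z \<in> up D z" using up_self[OF D z(1)] .
  have g_le: "1 \<le> g x" "g x \<le> length \<alpha>" if "x \<in> ?D" for x
    using g that by (auto simp: Ostar_def PiE_iff)
  have last: "{x\<in>D. f x = Suc (length \<alpha>)} = up D z"
    using g_le up_subset[of D z] by (force simp: f_def)
  have fib: "{x\<in>D. f x = i} = {x\<in>?D. g x = i}" if "i \<in> {1..length \<alpha>}" for i
    using that by (auto simp: f_def)
  have min: "is_minimal R (up D z) w \<longleftrightarrow> w = z" for w
    using zU R_antisym by (auto simp: is_minimal_def up_def z(2) strict_def)
  show "fiber_min R D f (Suc (length \<alpha>)) = z"
    unfolding fiber_min_def last min by simp
  have split: "{1..length (\<alpha> @ [card (up D z)])} = insert (Suc (length \<alpha>)) {1..length \<alpha>}"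
    by auto
  have "f ` D = f ` up D z \<union> f ` ?D" using up_subset[of D z] by auto
  moreover have "f ` up D z = {Suc (length \<alpha>)}" using zU up_subset[of D z] by (auto simp: f_def)
  moreover have "f ` ?D = g ` ?D" by (rule image_cong) (auto simp: f_def)
  moreover have "g ` ?D = {1..length \<alpha>}" using g by (simp add: Ostar_def)
  ultimately have im: "f ` D = insert (Suc (length \<alpha>)) {1..length \<alpha>}" by simp
  have mono: "f x \<le> f y" if "x \<in> D" "y \<in> D" "(x, y) \<in> R" for x y
  proof (cases "y \<in> up D z")
    case True
    then show ?thesis using that g_le[of x] by (auto simp: f_def)
  next
    case False
    then have "x \<notin> up D z" using up_R that by blast
    then show ?thesis using False that g by (auto simp: f_def Ostar_def)
  qed
  have compat: "f x = f y" if "x \<in> D" "y \<in> D" "(x, y) \<in> E" for x y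
    using up_E_iff[OF D z(1) that(3)] that g by (auto simp: f_def Ostar_def)
  have fibers: "card {x\<in>D. f x = i} = (\<alpha> @ [card (up D z)]) ! (i - 1)"
    "\<exists>!w. is_minimal R {x\<in>D. f x = i} w" if i: "i \<in> insert (Suc (length \<alpha>)) {1..length \<alpha>}" for i
  proof -
    consider "i = Suc (length \<alpha>)" | "i \<in> {1..length \<alpha>}" using i by blast
    then have "card {x\<in>D. f x = i} = (\<alpha> @ [card (up D z)]) ! (i - 1) \<and>
        (\<exists>!w. is_minimal R {x\<in>D. f x = i} w)"
    proof cases
      case 1
      then show ?thesis by (simp add: last min)
    next
      case 2
      have "i - 1 < length \<alpha>" using 2 by (auto simp: less_Suc_eq_le[symmetric])
      then show ?thesis using Ostar_fiber[OF g 2] by (simp add: fib[OF 2] nth_append)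
    qed
    then show "card {x\<in>D. f x = i} = (\<alpha> @ [card (up D z)]) ! (i - 1)"
      "\<exists>!w. is_minimal R {x\<in>D. f x = i} w" by auto
  qed
  have "f \<in> D \<rightarrow>\<^sub>E insert (Suc (length \<alpha>)) {1..length \<alpha>}"
    using im by (auto simp: f_def PiE_iff extensional_def)
  then show "f \<in> Ostar D R E (\<alpha> @ [card (up D z)])"
    by (intro OstarI im[folded split] mono compat fibers; simp only: split)
qed

text \<open>The maps are grouped by the minimum \<open>z\<close> of the last fibre, whose removal is
  a bijection. The remaining factor, the size of the class of \<open>z\<close>, is then spread over
  the members \<open>x\<close> of that class, all of which have the same
  \<open>up D x\<close>.\<close>

lemma coeffO_rec:
  assumes D: "ideal D"
  shows "coeffO D R E (\<alpha> @ [a]) =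
    (\<Sum>x\<in>{x\<in>D. card (up D x) = a}. coeffO (D - up D x) R E \<alpha>)"
proof -
  let ?S = "{x\<in>D. card (up D x) = a}"
  let ?Z = "{z\<in>?S. rep z = z}"
  let ?l = "Suc (length \<alpha>)"
  let ?w = "\<lambda>D f i. card (E `` {fiber_min R D f i})"
  note fin = ideal_finite[OF D]
  have up_rep: "up D (rep x) = up D x" if "x \<in> D" for x
    using rep_rep[OF ideal_carrier[OF D that]] by (simp add: up_def)
  have "coeffO D R E (\<alpha> @ [a]) = (\<Sum>f\<in>Ostar D R E (\<alpha> @ [a]). \<Prod>i\<in>{1..?l}. ?w D f i)"
    by (simp add: coeffO_def)
  also have "\<dots> = (\<Sum>z\<in>?Z. \<Sum>f\<in>{f \<in> Ostar D R E (\<alpha> @ [a]). fiber_min R D f ?l = z}.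
      \<Prod>i\<in>{1..?l}. ?w D f i)"
    by (rule sum.group[symmetric])
       (use fin finite_Ostar Ostar_last_fiber(1,2,4)[OF D] in auto)
  also have "\<dots> = (\<Sum>z\<in>?Z. card (E `` {z}) * coeffO (D - up D z) R E \<alpha>)"
  proof (rule sum.cong[OF refl])
    fix z assume z: "z \<in> ?Z"
    let ?U = "up D z"
    have "(\<Sum>f\<in>{f \<in> Ostar D R E (\<alpha> @ [a]). fiber_min R D f ?l = z}. \<Prod>i\<in>{1..?l}. ?w D f i)
        = (\<Sum>g\<in>Ostar (D - ?U) R E \<alpha>. card (E `` {z}) * (\<Prod>i\<in>{1..length \<alpha>}. ?w (D - ?U) g i))"
    proof (rule sum.reindex_bij_witness[of _
          "\<lambda>g. \<lambda>x\<in>D. if x \<in> ?U then ?l else g x" "\<lambda>f. restrict f (D - ?U)"])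
      fix f assume "f \<in> {f \<in> Ostar D R E (\<alpha> @ [a]). fiber_min R D f ?l = z}"
      then have f: "f \<in> Ostar D R E (\<alpha> @ [a])" and fz: "fiber_min R D f ?l = z" by auto
      have U: "x \<in> ?U \<longleftrightarrow> x \<in> D \<and> f x = ?l" for x
        by (simp add: Ostar_last_fiber(3)[OF D f, unfolded fz, symmetric])
      show "restrict f (D - ?U) \<in> Ostar (D - ?U) R E \<alpha>"
        using Ostar_restrict(1)[OF D f] by (simp only: fz)
      show "(\<lambda>x\<in>D. if x \<in> ?U then ?l else restrict f (D - ?U) x) = f"
      proof
        fix x
        show "(\<lambda>x\<in>D. if x \<in> ?U then ?l else restrict f (D - ?U) x) x = f x"
          using f by (auto simp: U Ostar_def PiE_iff extensional_def)
      qed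
      have "?w (D - ?U) (restrict f (D - ?U)) i = ?w D f i" if "i \<le> length \<alpha>" for i
        using Ostar_restrict(2)[OF D f that, unfolded fz] by (simp only: fiber_min_def)
      then show "card (E `` {z}) * (\<Prod>i\<in>{1..length \<alpha>}. ?w (D - ?U) (restrict f (D - ?U)) i)
          = (\<Prod>i\<in>{1..?l}. ?w D f i)"
        by (simp add: fz mult.commute)
    next
      fix g assume g: "g \<in> Ostar (D - ?U) R E \<alpha>"
      show "(\<lambda>x\<in>D. if x \<in> ?U then ?l else g x)
          \<in> {f \<in> Ostar D R E (\<alpha> @ [a]). fiber_min R D f ?l = z}"
        using Ostar_extend[OF D _ _ g] z by auto
      show "restrict (\<lambda>x\<in>D. if x \<in> ?U then ?l else g x) (D - ?U) = g"
      proof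
        fix x
        show "restrict (\<lambda>x\<in>D. if x \<in> ?U then ?l else g x) (D - ?U) x = g x"
          using g by (auto simp: Ostar_def PiE_iff extensional_def)
      qed
    qed
    then show "(\<Sum>f\<in>{f \<in> Ostar D R E (\<alpha> @ [a]). fiber_min R D f ?l = z}. \<Prod>i\<in>{1..?l}. ?w D f i)
        = card (E `` {z}) * coeffO (D - ?U) R E \<alpha>"
      by (simp only: coeffO_def sum_distrib_left)
  qed
  also have "\<dots> = (\<Sum>z\<in>?Z. \<Sum>x\<in>{x\<in>?S. rep x = z}. coeffO (D - up D x) R E \<alpha>)"
  proof (rule sum.cong[OF refl])
    fix z assume z: "z \<in> ?Z"
    \<comment> \<open>Saturation puts the whole class of \<open>z\<close> inside \<open>D\<close>,
      and its members share the up-set of \<open>z\<close>, so none is lost by the size condition in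
      \<open>?S\<close>.\<close>
    have cls: "{x\<in>?S. rep x = z} = E `` {z}"
    proof (intro set_eqI iffI)
      fix x assume "x \<in> {x\<in>?S. rep x = z}"
      then have "x \<in> D" "rep x = z" by auto
      then show "x \<in> E `` {z}" using E_sym[OF rep_E[OF ideal_carrier[OF D]], of x] by simp
    next
      fix x assume "x \<in> E `` {z}"
      then have zx: "(z, x) \<in> E" by simp
      then have "x \<in> D" using z ideal_E[OF D _ E_sym] by blast
      moreover have "rep x = z" using rep_eq[OF zx] z by simp
      ultimately show "x \<in> {x\<in>?S. rep x = z}" using z up_rep[of x] by auto
    qed
    have "(\<Sum>x\<in>{x\<in>?S. rep x = z}. coeffO (D - up D x) R E \<alpha>)
        = (\<Sum>x\<in>{x\<in>?S. rep x = z}. coeffO (D - up D z) R E \<alpha>)"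
      by (rule sum.cong[OF refl]) (use up_rep in auto)
    then show "card (E `` {z}) * coeffO (D - up D z) R E \<alpha> =
        (\<Sum>x\<in>{x\<in>?S. rep x = z}. coeffO (D - up D x) R E \<alpha>)"
      by (simp only: cls sum_constant) simp
  qed
  \<comment> \<open>Every \<open>x\<close> in \<open>?S\<close> lies over exactly one class minimum
    in \<open>?Z\<close>, namely \<open>rep x\<close>.\<close>
  also have "\<dots> = (\<Sum>x\<in>?S. coeffO (D - up D x) R E \<alpha>)"
  proof (rule sum.group)
    show "rep ` ?S \<subseteq> ?Z"
      using ideal_rep[OF D] up_rep rep_rep[OF ideal_carrier[OF D]] by auto
  qed (use fin in auto)
  finally show ?thesis .
qed

section \<open>Matching the two recursions\<close>

text \<open>The claim ranges over all ideals and all exponent vectors because each step shrinks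
  both; the removed up-set is nonempty, so \<open>card D\<close> drops.\<close>

lemma K_coeff_expansion:
  assumes "ideal D" "finite {i. m i \<noteq> 0}" "m 0 = 0"
  shows "of_nat (K_coeff D R E m) =
    (\<Sum>\<alpha>\<in>compositions (card D). refine_wt (rev \<alpha>) (rev (wt_of m)) * of_nat (coeffO D R E \<alpha>))"
  using assms
proof (induction "card D" arbitrary: D m rule: less_induct)
  case (less D m)
  note D = less.prems(1) and fm = less.prems(2) and m0 = less.prems(3)
  note fin = ideal_finite[OF D]
  show ?case
  proof (cases "D = {}")
    case True
    \<comment> \<open>On the empty carrier the only extensional map is constantly
      \<open>undefined\<close>; it is counted by \<open>K_maps\<close> exactly when \<open>m\<close>
      is zero.\<close>
    have "Ostar {} R E [] = {\<lambda>_. undefined}" by (auto simp: Ostar_def)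
    then have "coeffO {} R E [] = 1" by (simp add: coeffO_def)
    moreover have "K_maps {} R E m = (if {i. m i \<noteq> 0} = {} then {\<lambda>_. undefined} else {})"
      by (auto simp: K_maps_def)
    moreover have "refine_wt [] (rev (wt_of m)) = (if {i. m i \<noteq> 0} = {} then 1 else 0)"
    proof (cases "{i. m i \<noteq> 0} = {}")
      case False
      then have "wt_of m \<noteq> []" using fm by (simp add: wt_of_def)
      then show ?thesis using False by (cases "wt_of m" rule: rev_cases) auto
    qed (simp add: wt_of_def)
    ultimately show ?thesis
      using True by (simp add: compositions_0 K_coeff_eq_card)
  next
    case ne: False
    then have cD: "0 < card D" using fin by (simp add: card_gt_0_iff)
    show ?thesis
    proof (cases "{i. m i \<noteq> 0} = {}")
      case True
      \<comment> \<open>Any value of a map would need a nonzero exponent. On the other side every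
        composition of \<open>card D\<close> is nonempty, and \<open>refine_wt\<close> against
        \<open>[]\<close> is 0.\<close>
      then have "K_maps D R E m = {}" using K_maps_value[OF fin] ne by blast
      moreover have "wt_of m = []" using True by (simp add: wt_of_def)
      ultimately show ?thesis
        by (simp add: K_coeff_eq_card sum_compositions_snoc[OF cD])
    next
      case False
      define k where "k = Max {i. m i \<noteq> 0}"
      have k: "m k \<noteq> 0" "\<forall>i. m i \<noteq> 0 \<longrightarrow> i \<le> k"
        using Max_in[OF fm False] Max_ge[OF fm] by (auto simp: k_def)
      let ?b = "m k"
      let ?W = "\<lambda>m \<alpha>. refine_wt (rev \<alpha>) (rev (wt_of m))"
      let ?m = "\<lambda>a. m(k := ?b - a)"
      \<comment> \<open>For \<open>a < ?b\<close> the head is lowered; for \<open>a = ?b\<close> the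
        exponent at \<open>k\<close> becomes 0 and \<open>wt_of\<close> drops it. Thus
        \<open>?m a\<close> describes both nonzero branches.\<close>
      have wt: "refine_wt (a # rev \<alpha>) (rev (wt_of m)) = (if a \<le> ?b then ?W (?m a) \<alpha> / of_nat ?b else 0)" for \<alpha> a
      proof -
        have "refine_wt (a # rev \<alpha>) (rev (wt_of m))
            = refine_wt (a # rev \<alpha>) (?b # rev (wt_of (m(k := 0))))"
          by (simp only: rev_wt_of_Max(1)[OF fm k])
        then show ?thesis using rev_wt_of_Max(2)[OF fm k, of "?b - a"] by auto
      qed
      have "(\<Sum>\<alpha>\<in>compositions (card D). ?W m \<alpha> * of_nat (coeffO D R E \<alpha>))
          = (\<Sum>a\<in>{1..card D}. \<Sum>\<alpha>\<in>compositions (card D - a).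
              ?W m (\<alpha> @ [a]) * of_nat (coeffO D R E (\<alpha> @ [a])))"
        by (rule sum_compositions_snoc[OF cD])
      also have "\<dots> = (\<Sum>a\<in>{1..card D}. \<Sum>\<alpha>\<in>compositions (card D - a).
          \<Sum>x\<in>{x\<in>D. card (up D x) = a}. ?W m (\<alpha> @ [a]) * of_nat (coeffO (D - up D x) R E \<alpha>))"
        by (simp add: coeffO_rec[OF D] sum_distrib_left)
      also have "\<dots> = (\<Sum>a\<in>{1..card D}. \<Sum>x\<in>{x\<in>D. card (up D x) = a}.
          \<Sum>\<alpha>\<in>compositions (card D - a). ?W m (\<alpha> @ [a]) * of_nat (coeffO (D - up D x) R E \<alpha>))"
        by (intro sum.cong refl sum.swap)
      \<comment> \<open>Inside the sum \<open>a\<close> is \<open>card (up D x)\<close> and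
        \<open>card D - a\<close> is the size of the remaining ideal, so the terms depend on
        \<open>x\<close> alone and the grouping by \<open>a\<close> can be dissolved.\<close>
      also have "\<dots> = (\<Sum>a\<in>{1..card D}. \<Sum>x\<in>{x\<in>D. card (up D x) = a}.
          \<Sum>\<alpha>\<in>compositions (card (D - up D x)).
            ?W m (\<alpha> @ [card (up D x)]) * of_nat (coeffO (D - up D x) R E \<alpha>))"
        by (intro sum.cong refl) (auto simp: card_diff_up[OF D])
      also have "\<dots> = (\<Sum>x\<in>D. \<Sum>\<alpha>\<in>compositions (card (D - up D x)).
            ?W m (\<alpha> @ [card (up D x)]) * of_nat (coeffO (D - up D x) R E \<alpha>))"
        by (rule sum.group) (use fin card_diff_up[OF D] in \<open>auto simp: Suc_le_eq\<close>)
      also have "\<dots> = (\<Sum>x\<in>D. of_nat (if card (up D x) \<le> ?b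
            then K_coeff (D - up D x) R E (?m (card (up D x))) else 0) / of_nat ?b)"
      proof (rule sum.cong[OF refl])
        fix x assume x: "x \<in> D"
        let ?a = "card (up D x)" and ?D = "D - up D x"
        have "of_nat (K_coeff ?D R E (?m ?a)) =
            (\<Sum>\<alpha>\<in>compositions (card ?D). ?W (?m ?a) \<alpha> * of_nat (coeffO ?D R E \<alpha>))"
        proof (rule less.hyps)
          show "card ?D < card D" using card_diff_up[OF D x] by linarith
          show "ideal ?D" using ideal_diff_up[OF D x] .
          show "finite {i. ?m ?a i \<noteq> 0}"
            by (rule finite_subset[OF _ fm]) (use k(1) in auto)
          show "?m ?a 0 = 0" using m0 k(1) by auto
        qed
        then show "(\<Sum>\<alpha>\<in>compositions (card ?D). ?W m (\<alpha> @ [?a]) * of_nat (coeffO ?D R E \<alpha>))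
          = of_nat (if ?a \<le> ?b then K_coeff ?D R E (?m ?a) else 0) / of_nat ?b"
          by (simp add: wt sum_divide_distrib)
      qed
      \<comment> \<open>The factor \<open>1 / ?b\<close> from \<open>wt\<close> cancels the
        multiplicity \<open>m k\<close> in \<open>K_coeff_rec\<close>.\<close>
      also have "\<dots> = of_nat (m k * K_coeff D R E m) / of_nat ?b"
        unfolding K_coeff_rec[OF D fm k m0] by (simp only: of_nat_sum sum_divide_distrib)
      also have "\<dots> = of_nat (K_coeff D R E m)" using k(1) by simp
      finally show ?thesis ..
    qed
  qed
qed

end

theorem theorem6p2:
  fixes P :: "'a set" and R E :: "('a \<times> 'a) set" and n :: nat
  assumes "finite P" and "card P = n"
    and "partial_order_on P R"
    and "chain_congruence P R E"
  shows "\<forall>m :: nat \<Rightarrow> nat. finite {i. m i \<noteq> 0} \<and> m 0 = 0 \<longrightarrow>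
           of_nat (K_coeff P R E m) =
           (\<Sum>\<alpha>\<in>compositions n. Psi_coeff \<alpha> m / of_nat (zee \<alpha>) * of_nat (coeffO P R E \<alpha>))"
proof (intro allI impI, elim conjE)
  interpret chain_congruence_poset P R E
    using assms by unfold_locales
  fix m :: "nat \<Rightarrow> nat"
  assume m: "finite {i. m i \<noteq> 0}" "m 0 = 0"
  \<comment> \<open>Once the normalised \<Psi> coefficients are rewritten as
    \<open>refine_wt\<close>, the claim is the expansion for the ideal \<open>P\<close>
    itself.\<close>
  have "(\<Sum>\<alpha>\<in>compositions n. Psi_coeff \<alpha> m / of_nat (zee \<alpha>) * of_nat (coeffO P R E \<alpha>))
      = (\<Sum>\<alpha>\<in>compositions (card P). refine_wt (rev \<alpha>) (rev (wt_of m)) * of_nat (coeffO P R E \<alpha>))"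
    using assms(2) Psi_coeff_eq_refine_wt[OF m(1)]
    by (intro sum.cong) (auto simp: compositions_def)
  then show "of_nat (K_coeff P R E m) =
      (\<Sum>\<alpha>\<in>compositions n. Psi_coeff \<alpha> m / of_nat (zee \<alpha>) * of_nat (coeffO P R E \<alpha>))"
    using K_coeff_expansion[OF ideal_P m] by simp
qed

end
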